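(* Let $g:[0,\infty)\to\mathbb{R}$ be continuous and bounded. For any $\varepsilon>0$ and any $\lambda\in\mathbb{R}$, there is an $\alpha\in\mathbb{R}$ such that the solution of $$\varepsilon^2u''=u^3-\lambda u+g(t),\qquad u(0)=\alpha,\quad u'(0)=0,$$ exists on $[0,\infty)$ and is bounded there. *)

theory Defs
  imports "HOL-Analysis.Analysis"
begin

text \<open>The witnesses \<open>u'\<close> and \<open>u''\<close> are the first and second derivatives of \<open>u\<close> on
  \<open>[0, \<infinity>)\<close>, one-sided at \<open>0\<close>. The values of \<open>u\<close> and \<open>g\<close> on the negative axis are irrelevant.\<close>

definition solves_ivp ::
    "(real \<Rightarrow> real) \<Rightarrow> real \<Rightarrow> real \<Rightarrow> real \<Rightarrow> (real \<Rightarrow> real) \<Rightarrow> bool" where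
  "solves_ivp g \<epsilon> lam \<alpha> u \<longleftrightarrow>
     (\<exists>u' u''.
        (\<forall>t\<ge>0. (u has_real_derivative u' t) (at t within {0..}) \<and>
               (u' has_real_derivative u'' t) (at t within {0..}) \<and>
               \<epsilon>\<^sup>2 * u'' t = (u t) ^ 3 - lam * u t + g t) \<and>
        u 0 = \<alpha> \<and> u' 0 = 0)"

end

theory Submission
  imports Defs
begin

text \<open>With \<open>f t x = (x ^ 3 - lam * x + g t) / \<epsilon>\<^sup>2\<close>, a large constant \<open>M\<close> is an upper and \<open>-M\<close> a lower
  solution, and \<open>F t x = \<kappa>\<^sup>2 * x - f t x\<close> is nondecreasing in \<open>x \<in> {-M..M}\<close> once \<open>\<kappa>\<close> is large. Bounded
  solutions of \<open>u'' = f t u\<close>, \<open>u' 0 = 0\<close> are the fixed points of \<open>v \<mapsto> G (F (v))\<close>, where \<open>G\<close> is the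
  positive Green operator of \<open>- u'' + \<kappa>\<^sup>2 * u\<close> on the half-line with a Neumann condition at \<open>0\<close>. This map
  is monotone, so iterating it from the constant \<open>M\<close> gives a decreasing sequence bounded below by \<open>-M\<close>,
  whose limit is a fixed point by dominated convergence. No shooting is needed: \<open>\<alpha>\<close> is just
  \<open>u 0\<close>, and uniqueness for the initial value problem makes every solution with this \<open>\<alpha>\<close> bounded.\<close>

section \<open>The Green operator\<close>

text \<open>Integrability against both exponentials, rather than continuity, because the limit of
  the iteration is only a pointwise limit until it is recognised as a fixed point. The condition
  survives bounded pointwise limits, and it keeps \<open>integral\<close> from taking its default
  value 0.\<close>

definition kernel_integrable :: "real \<Rightarrow> (real \<Rightarrow> real) \<Rightarrow> bool" where
  "kernel_integrable \<kappa> h \<longleftrightarrow>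
     (\<forall>t\<ge>0. (\<lambda>s. exp (\<kappa> * s) * h s) integrable_on {0..t} \<and>
            (\<lambda>s. exp (-\<kappa> * s) * h s) integrable_on {t..})"

text \<open>Integration of \<open>h\<close> against the kernel \<open>(exp (-\<kappa> * \<bar>t - s\<bar>) + exp (-\<kappa> * (t + s))) / (2 * \<kappa>)\<close>, with the
  exponentials in \<open>t\<close> pulled out of the integrals so that it can be differentiated.\<close>

definition neumann_green :: "real \<Rightarrow> (real \<Rightarrow> real) \<Rightarrow> real \<Rightarrow> real" where
  "neumann_green \<kappa> h t =
     (exp (-\<kappa> * t) * integral {0..t} (\<lambda>s. exp (\<kappa> * s) * h s) +
      exp (\<kappa> * t) * integral {t..} (\<lambda>s. exp (-\<kappa> * s) * h s) +
      exp (-\<kappa> * t) * integral {0..} (\<lambda>s. exp (-\<kappa> * s) * h s)) / (2 * \<kappa>)"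

lemma kernel_integrable_continuous:
  assumes "\<kappa> > 0" and cont: "continuous_on {0..} h" and bound: "\<And>s. s \<ge> 0 \<Longrightarrow> \<bar>h s\<bar> \<le> C"
  shows "kernel_integrable \<kappa> h"
  unfolding kernel_integrable_def
proof (intro allI impI conjI)
  fix t :: real assume t: "t \<ge> 0"
  have cont0: "continuous_on {0..t} h" and cont1: "continuous_on {t..} h"
    using t by (auto intro: continuous_on_subset[OF cont])
  show "(\<lambda>s. exp (\<kappa> * s) * h s) integrable_on {0..t}"
    by (intro integrable_continuous_real continuous_intros cont0)
  show "(\<lambda>s. exp (-\<kappa> * s) * h s) integrable_on {t..}"
  proof (rule measurable_bounded_by_integrable_imp_integrable)
    show "(\<lambda>s. exp (-\<kappa> * s) * h s) \<in> borel_measurable (lebesgue_on {t..})"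
      by (intro continuous_imp_measurable_on_sets_lebesgue continuous_intros cont1) auto
    show "(\<lambda>s. exp (-\<kappa> * s) * C) integrable_on {t..}"
      using integrable_on_cmult_right[OF integrable_on_exp_minus_to_infinity[OF \<open>\<kappa> > 0\<close>], of C t]
      by (simp add: mult.commute)
    show "norm (exp (-\<kappa> * s) * h s) \<le> exp (-\<kappa> * s) * C" if "s \<in> {t..}" for s
      using bound[of s] that t by (simp add: abs_mult)
  qed auto
qed

text \<open>All three exponential weights and the factor \<open>1 / (2 * \<kappa>)\<close> are
  positive, so the order passes through each integral.\<close>

lemma neumann_green_mono:
  assumes "\<kappa> > 0" "t \<ge> 0" and k: "kernel_integrable \<kappa> h" "kernel_integrable \<kappa> h'"
    and le: "\<And>s. s \<ge> 0 \<Longrightarrow> h s \<le> h' s"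
  shows "neumann_green \<kappa> h t \<le> neumann_green \<kappa> h' t"
  unfolding neumann_green_def using assms
  by (intro divide_right_mono add_mono mult_left_mono integral_le)
    (auto simp: kernel_integrable_def)

text \<open>The constant \<open>M\<close> is the bounded Neumann solution of
  \<open>- u'' + \<kappa>\<^sup>2 * u = \<kappa>\<^sup>2 * M\<close>; here this is checked by
  computing the integrals. It turns the barrier inequalities for \<open>F\<close> into bounds on the
  iterates.\<close>

lemma neumann_green_const:
  assumes "\<kappa> > 0" "t \<ge> 0"
  shows "neumann_green \<kappa> (\<lambda>_. \<kappa>\<^sup>2 * M) t = M"
proof -
  have tail: "integral {c..} (\<lambda>s. exp (-\<kappa> * s) * (\<kappa>\<^sup>2 * M)) = exp (-\<kappa> * c) / \<kappa> * (\<kappa>\<^sup>2 * M)" for c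
    by (intro integral_unique has_integral_mult_left has_integral_exp_minus_to_infinity assms)
  have head: "integral {0..t} (\<lambda>s. exp (\<kappa> * s) * (\<kappa>\<^sup>2 * M)) = exp (\<kappa> * t) * (\<kappa> * M) - exp (\<kappa> * 0) * (\<kappa> * M)"
    using assms
    by (intro integral_unique fundamental_theorem_of_calculus)
      (auto intro!: derivative_eq_intros simp flip: has_real_derivative_iff_has_vector_derivative
        simp: power2_eq_square)
  have "exp (\<kappa> * t) * exp (-\<kappa> * t) = 1"
    by (simp flip: exp_add)
  then show ?thesis
    unfolding neumann_green_def tail head
    using assms by (simp add: field_simps power2_eq_square)
qed

text \<open>Trades the moving lower limit of the tail for a moving upper limit, so that the theorems
  on indefinite integrals over compact intervals apply.\<close>

lemma neumann_green_split:
  assumes "kernel_integrable \<kappa> h" "t \<ge> 0"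
  shows "integral {t..} (\<lambda>s. exp (-\<kappa> * s) * h s) =
    integral {0..} (\<lambda>s. exp (-\<kappa> * s) * h s) - integral {0..t} (\<lambda>s. exp (-\<kappa> * s) * h s)"
    and "(\<lambda>s. exp (-\<kappa> * s) * h s) integrable_on {0..t}"
proof -
  let ?f = "\<lambda>s. exp (-\<kappa> * s) * h s"
  have int: "?f integrable_on {0..}" "?f integrable_on {t..}"
    using assms by (auto simp: kernel_integrable_def)
  show int0: "?f integrable_on {0..t}"
    by (rule integrable_on_subinterval[OF int(1)]) auto
  have "{0..t} \<inter> {t..} = {t}" "{0..t} \<union> {t..} = {0..}"
    using assms(2) by auto
  then have "integral {0..} ?f = integral {0..t} ?f + integral {t..} ?f"
    using integral_Un[OF int0 int(2)] by simp
  then show "integral {t..} ?f = integral {0..} ?f - integral {0..t} ?f"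
    by simp
qed

text \<open>Localises the half-line to a compact interval; the margin 1 keeps \<open>t\<close> away
  from the right end, so the filter is unchanged.\<close>

lemma at_within_atLeast_eq:
  fixes t :: real
  shows "at t within {0..} = at t within {0..t+1}"
  by (rule at_within_nhd[of _ "{..<t+1}"]) auto

text \<open>Indefinite integrals are continuous for merely integrable \<open>h\<close>. This is what
  later gives the limit of the iteration its continuity without circularity.\<close>

lemma continuous_on_neumann_green:
  assumes "kernel_integrable \<kappa> h" "\<kappa> > 0"
  shows "continuous_on {0..} (neumann_green \<kappa> h)"
  unfolding continuous_on_eq_continuous_within
proof
  fix t :: real assume "t \<in> {0..}"
  then have t: "t \<ge> 0" by simp
  let ?I = "integral {0..} (\<lambda>s. exp (-\<kappa> * s) * h s)"
  have "continuous_on {0..t+1} (\<lambda>t. (exp (-\<kappa> * t) * integral {0..t} (\<lambda>s. exp (\<kappa> * s) * h s) +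
      exp (\<kappa> * t) * (?I - integral {0..t} (\<lambda>s. exp (-\<kappa> * s) * h s)) + exp (-\<kappa> * t) * ?I) / (2 * \<kappa>))"
    using assms t neumann_green_split(2)[OF assms(1), of "t+1"]
    by (intro continuous_intros indefinite_integral_continuous_1) (auto simp: kernel_integrable_def)
  then have "continuous_on {0..t+1} (neumann_green \<kappa> h)"
  proof (rule continuous_on_eq)
    fix x assume "x \<in> {0..t+1}"
    then show "(exp (-\<kappa> * x) * integral {0..x} (\<lambda>s. exp (\<kappa> * s) * h s) +
      exp (\<kappa> * x) * (?I - integral {0..x} (\<lambda>s. exp (-\<kappa> * s) * h s)) + exp (-\<kappa> * x) * ?I) / (2 * \<kappa>)
      = neumann_green \<kappa> h x"
      using neumann_green_split(1)[OF assms(1), of x] by (simp add: neumann_green_def)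
  qed
  then show "continuous (at t within {0..}) (neumann_green \<kappa> h)"
    using t unfolding continuous_on_eq_continuous_within at_within_atLeast_eq by auto
qed

lemma neumann_green_solves:
  assumes k: "kernel_integrable \<kappa> h" and "\<kappa> > 0" and cont: "continuous_on {0..} h"
  obtains u' where "u' 0 = 0"
    "\<And>t. t \<ge> 0 \<Longrightarrow> (neumann_green \<kappa> h has_real_derivative u' t) (at t within {0..})"
    "\<And>t. t \<ge> 0 \<Longrightarrow> (u' has_real_derivative \<kappa>\<^sup>2 * neumann_green \<kappa> h t - h t) (at t within {0..})"
proof -
  define A where "A t = integral {0..t} (\<lambda>s. exp (\<kappa> * s) * h s)" for t
  define B where "B t = integral {0..t} (\<lambda>s. exp (-\<kappa> * s) * h s)" for t
  define I where "I = integral {0..} (\<lambda>s. exp (-\<kappa> * s) * h s)"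
  define u where "u t = (exp (-\<kappa> * t) * A t + exp (\<kappa> * t) * (I - B t) + exp (-\<kappa> * t) * I) / (2 * \<kappa>)" for t
  \<comment> \<open>Differentiating \<open>A\<close> and \<open>B\<close> inside \<open>u\<close>
    contributes \<open>h t\<close> and \<open>- h t\<close>, which cancel, so only the exponentials
    are differentiated. At 0 both \<open>A\<close> and \<open>B\<close> vanish and the two
    \<open>I\<close> terms cancel: the reflected part of the kernel enforces the Neumann
    condition.\<close>
  define u' where "u' t = (- exp (-\<kappa> * t) * A t + exp (\<kappa> * t) * (I - B t) - exp (-\<kappa> * t) * I) / 2" for t
  have green: "neumann_green \<kappa> h t = u t" if "t \<ge> 0" for t
    using neumann_green_split(1)[OF k that] by (simp add: neumann_green_def u_def A_def B_def I_def)
  have inv: "exp (\<kappa> * t) * exp (-\<kappa> * t) = 1" for t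
    by (simp flip: exp_add)
  have cont': "continuous_on {0..t+1} h" for t
    by (rule continuous_on_subset[OF cont]) auto
  have A': "(A has_real_derivative exp (\<kappa> * t) * h t) (at t within {0..})" if "t \<ge> 0" for t
    unfolding at_within_atLeast_eq A_def using that
    by (intro integral_has_real_derivative continuous_intros cont') auto
  have B': "(B has_real_derivative exp (-\<kappa> * t) * h t) (at t within {0..})" if "t \<ge> 0" for t
    unfolding at_within_atLeast_eq B_def using that
    by (intro integral_has_real_derivative continuous_intros cont') auto
  have u: "(u has_real_derivative u' t) (at t within {0..})" if "t \<ge> 0" for t
  proof -
    have "((\<lambda>t. exp (-\<kappa> * t) * A t + exp (\<kappa> * t) * (I - B t) + exp (-\<kappa> * t) * I)
        has_real_derivative \<kappa> * (2 * u' t)) (at t within {0..})"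
      unfolding u'_def by (auto intro!: derivative_eq_intros A' B' that simp: algebra_simps)
    from DERIV_cdivide[OF this, of "2 * \<kappa>"] show ?thesis
      unfolding u_def using \<open>\<kappa> > 0\<close> by simp
  qed
  have u'': "(u' has_real_derivative \<kappa>\<^sup>2 * u t - h t) (at t within {0..})" if "t \<ge> 0" for t
  proof -
    have u_eq: "2 * \<kappa> * u t = exp (-\<kappa> * t) * A t + exp (\<kappa> * t) * (I - B t) + exp (-\<kappa> * t) * I"
      using \<open>\<kappa> > 0\<close> by (simp add: u_def)
    \<comment> \<open>Here the contributions of \<open>A\<close> and \<open>B\<close> add up instead
      of cancelling. The product of exponentials stays unevaluated until \<open>inv\<close> reduces
      it to 1, leaving \<open>- h t\<close> after halving.\<close>
    have "((\<lambda>t. - exp (-\<kappa> * t) * A t + exp (\<kappa> * t) * (I - B t) - exp (-\<kappa> * t) * I)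
        has_real_derivative \<kappa> * (2 * \<kappa> * u t) - 2 * (exp (\<kappa> * t) * exp (-\<kappa> * t)) * h t) (at t within {0..})"
      unfolding u_eq
      by (auto intro!: derivative_eq_intros A' B' that simp: algebra_simps)
    from DERIV_cdivide[OF this, of 2] show ?thesis
      unfolding u'_def inv by (simp add: power2_eq_square diff_divide_distrib mult.assoc)
  qed
  show ?thesis
  proof
    show "u' 0 = 0" by (simp add: u'_def A_def B_def)
    show "(neumann_green \<kappa> h has_real_derivative u' t) (at t within {0..})" if "t \<ge> 0" for t
      by (rule has_field_derivative_transform_within[OF u[OF that] zero_less_one]) (use that green in auto)
    show "(u' has_real_derivative \<kappa>\<^sup>2 * neumann_green \<kappa> h t - h t) (at t within {0..})" if "t \<ge> 0" for t
      using u''[OF that] green[OF that] by simp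
  qed
qed

text \<open>The majorants are \<open>C\<close> times the growing exponential on
  \<open>{0..t}\<close> and \<open>C\<close> times the decaying one on the tail. Integrability of
  the limit comes out of the same theorem as the convergence.\<close>

lemma neumann_green_dominated_convergence:
  assumes "\<kappa> > 0" and k: "\<And>n. kernel_integrable \<kappa> (h n)"
    and bound: "\<And>n s. s \<ge> 0 \<Longrightarrow> \<bar>h n s\<bar> \<le> C"
    and lim: "\<And>s. s \<ge> 0 \<Longrightarrow> (\<lambda>n. h n s) \<longlonglongrightarrow> l s"
  shows "kernel_integrable \<kappa> l"
    and "t \<ge> 0 \<Longrightarrow> (\<lambda>n. neumann_green \<kappa> (h n) t) \<longlonglongrightarrow> neumann_green \<kappa> l t"
proof -
  have head: "(\<lambda>s. exp (\<kappa> * s) * l s) integrable_on {0..t} \<and>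
      (\<lambda>n. integral {0..t} (\<lambda>s. exp (\<kappa> * s) * h n s)) \<longlonglongrightarrow> integral {0..t} (\<lambda>s. exp (\<kappa> * s) * l s)"
    if "t \<ge> 0" for t
  proof -
    have "(\<lambda>s. exp (\<kappa> * s) * h n s) integrable_on {0..t}" for n
      using k that by (simp add: kernel_integrable_def)
    moreover have "(\<lambda>s. exp (\<kappa> * s) * C) integrable_on {0..t}"
      by (intro integrable_continuous_real continuous_intros)
    moreover have "norm (exp (\<kappa> * s) * h n s) \<le> exp (\<kappa> * s) * C" if "s \<in> {0..t}" for n s
      using bound[of s n] that \<open>t \<ge> 0\<close> by (simp add: abs_mult)
    moreover have "(\<lambda>n. exp (\<kappa> * s) * h n s) \<longlonglongrightarrow> exp (\<kappa> * s) * l s" if "s \<in> {0..t}" for s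
      using that \<open>t \<ge> 0\<close> by (intro tendsto_intros lim) auto
    ultimately show ?thesis
      by (intro conjI; rule dominated_convergence)
  qed
  have tail: "(\<lambda>s. exp (-\<kappa> * s) * l s) integrable_on {t..} \<and>
      (\<lambda>n. integral {t..} (\<lambda>s. exp (-\<kappa> * s) * h n s)) \<longlonglongrightarrow> integral {t..} (\<lambda>s. exp (-\<kappa> * s) * l s)"
    if "t \<ge> 0" for t
  proof -
    have "(\<lambda>s. exp (-\<kappa> * s) * h n s) integrable_on {t..}" for n
      using k that by (simp add: kernel_integrable_def)
    moreover have "(\<lambda>s. exp (-\<kappa> * s) * C) integrable_on {t..}"
      using integrable_on_cmult_right[OF integrable_on_exp_minus_to_infinity[OF \<open>\<kappa> > 0\<close>], of C t]
      by (simp add: mult.commute)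
    moreover have "norm (exp (-\<kappa> * s) * h n s) \<le> exp (-\<kappa> * s) * C" if "s \<in> {t..}" for n s
      using bound[of s n] that \<open>t \<ge> 0\<close> by (simp add: abs_mult)
    moreover have "(\<lambda>n. exp (-\<kappa> * s) * h n s) \<longlonglongrightarrow> exp (-\<kappa> * s) * l s" if "s \<in> {t..}" for s
      using that \<open>t \<ge> 0\<close> by (intro tendsto_intros lim) auto
    ultimately show ?thesis
      by (intro conjI; rule dominated_convergence)
  qed
  show "kernel_integrable \<kappa> l"
    using head tail by (simp add: kernel_integrable_def)
  show "(\<lambda>n. neumann_green \<kappa> (h n) t) \<longlonglongrightarrow> neumann_green \<kappa> l t" if "t \<ge> 0"
    unfolding neumann_green_def using head[OF that] tail[OF that] tail[of 0] \<open>\<kappa> > 0\<close>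
    by (intro tendsto_intros) auto
qed

section \<open>Monotone iteration\<close>

lemma neumann_bounded_solution:
  assumes "\<kappa> > 0" and M: "M \<ge> 0"
    and cont: "continuous_on ({0..} \<times> {-M..M}) (\<lambda>(t, x). F t x)"
    and mono: "\<And>t x y. t \<ge> 0 \<Longrightarrow> -M \<le> x \<Longrightarrow> x \<le> y \<Longrightarrow> y \<le> M \<Longrightarrow> F t x \<le> F t y"
    and upper: "\<And>t. t \<ge> 0 \<Longrightarrow> F t M \<le> \<kappa>\<^sup>2 * M"
    and lower: "\<And>t. t \<ge> 0 \<Longrightarrow> \<kappa>\<^sup>2 * (-M) \<le> F t (-M)"
  obtains u u' where "u' 0 = 0" "\<And>t. t \<ge> 0 \<Longrightarrow> \<bar>u t\<bar> \<le> M"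
    "\<And>t. t \<ge> 0 \<Longrightarrow> (u has_real_derivative u' t) (at t within {0..})"
    "\<And>t. t \<ge> 0 \<Longrightarrow> (u' has_real_derivative \<kappa>\<^sup>2 * u t - F t (u t)) (at t within {0..})"
proof -
  \<comment> \<open>Continuity is included because it makes \<open>F s (v s)\<close> continuous in
    \<open>s\<close>, hence \<open>kernel_integrable\<close>, for every iterate.\<close>
  define between where "between v \<longleftrightarrow> continuous_on {0..} v \<and> (\<forall>t\<ge>0. v t \<in> {-M..M})"
    for v :: "real \<Rightarrow> real"
  define T where "T v = neumann_green \<kappa> (\<lambda>s. F s (v s))" for v :: "real \<Rightarrow> real"
  \<comment> \<open>Monotonicity in \<open>x\<close> carries the barrier inequalities at
    \<open>M\<close> and \<open>-M\<close> to the whole strip.\<close>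
  have F_bound: "\<kappa>\<^sup>2 * (-M) \<le> F t x" "F t x \<le> \<kappa>\<^sup>2 * M" if "t \<ge> 0" "x \<in> {-M..M}" for t x
    using mono[of t "-M" x] mono[of t x M] upper[of t] lower[of t] that by auto
  have F_abs: "\<bar>F t x\<bar> \<le> \<kappa>\<^sup>2 * M" if "t \<ge> 0" "x \<in> {-M..M}" for t x
    using F_bound[OF that] by (simp add: abs_le_iff)
  have F_cont: "continuous_on {0..} (\<lambda>s. F s (v s))" if "between v" for v
  proof -
    have "continuous_on {0..} (\<lambda>s. (\<lambda>(t, x). F t x) (s, v s))"
      by (rule continuous_on_compose2[OF cont])
        (use that in \<open>auto simp: between_def intro!: continuous_intros\<close>)
    then show ?thesis by simp
  qed
  have F_ki: "kernel_integrable \<kappa> (\<lambda>s. F s (v s))" if "between v" for v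
    by (rule kernel_integrable_continuous[OF \<open>\<kappa> > 0\<close> F_cont[OF that], of "\<kappa>\<^sup>2 * M"])
      (use that F_abs in \<open>auto simp: between_def\<close>)
  have const_ki: "kernel_integrable \<kappa> (\<lambda>_. c)" for c
    by (rule kernel_integrable_continuous[OF \<open>\<kappa> > 0\<close>, of _ "\<bar>c\<bar>"]) auto
  have T_mono: "T v t \<le> T w t" if "between v" "between w" "\<And>s. s \<ge> 0 \<Longrightarrow> v s \<le> w s" "t \<ge> 0" for v w t
    unfolding T_def
    by (rule neumann_green_mono) (use that \<open>\<kappa> > 0\<close> F_ki in \<open>auto simp: between_def intro!: mono\<close>)
  have T_between: "between (T v)" if "between v" for v
  proof -
    have "T v t \<le> neumann_green \<kappa> (\<lambda>_. \<kappa>\<^sup>2 * M) t" "neumann_green \<kappa> (\<lambda>_. \<kappa>\<^sup>2 * (-M)) t \<le> T v t"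
      if "t \<ge> 0" for t
      unfolding T_def using \<open>between v\<close>
      by (intro neumann_green_mono \<open>\<kappa> > 0\<close> that F_ki const_ki F_bound; simp add: between_def)+
    then have "T v t \<in> {-M..M}" if "t \<ge> 0" for t
      using that by (metis neumann_green_const[OF \<open>\<kappa> > 0\<close> that] atLeastAtMost_iff)
    then show ?thesis
      using continuous_on_neumann_green[OF F_ki[OF that] \<open>\<kappa> > 0\<close>] by (simp add: between_def T_def)
  qed
  define U where "U n = (T ^^ n) (\<lambda>_. M)" for n
  have U_Suc: "U (Suc n) = T (U n)" for n by (simp add: U_def)
  have U_between: "between (U n)" for n
    by (induction n) (use M in \<open>auto simp: U_Suc T_between\<close>, auto simp: U_def between_def)
  have U_dec: "U (Suc n) t \<le> U n t" if "t \<ge> 0" for n t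
    using that
  proof (induction n arbitrary: t)
    \<comment> \<open>\<open>U 0\<close> is the constant \<open>M\<close>, so the base case only
      says that \<open>U 1\<close> stays in the strip.\<close>
    case 0
    then show ?case using U_between[of 1] by (simp add: between_def) (simp add: U_def)
  next
    case (Suc n)
    show ?case
      using T_mono[OF U_between U_between Suc.IH Suc.prems] by (simp only: U_Suc)
  qed
  have "\<exists>l. (\<lambda>n. U n t) \<longlonglongrightarrow> l" if "t \<ge> 0" for t
  proof -
    have "decseq (\<lambda>n. U n t)" using U_dec that by (simp add: decseq_Suc_iff)
    moreover have "-M \<le> U n t" for n using U_between[of n] that by (auto simp: between_def)
    ultimately show ?thesis using decseq_convergent by blast
  qed
  then obtain u where u: "(\<lambda>n. U n t) \<longlonglongrightarrow> u t" if "t \<ge> 0" for t by metis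
  have U_in: "U n t \<in> {-M..M}" if "t \<ge> 0" for n t
    using U_between[of n] that by (auto simp: between_def)
  have u_in: "u t \<in> {-M..M}" if "t \<ge> 0" for t
    by (rule closed_sequentially[OF closed_atLeastAtMost _ u[OF that]]) (use U_in that in auto)
  have F_lim: "(\<lambda>n. F t (U n t)) \<longlonglongrightarrow> F t (u t)" if "t \<ge> 0" for t
  proof -
    have "continuous_on {-M..M} (\<lambda>x. (\<lambda>(t, x). F t x) (t, x))"
      by (rule continuous_on_compose2[OF cont]) (use that in \<open>auto intro!: continuous_intros\<close>)
    then have "continuous_on {-M..M} (F t)" by simp
    from continuous_on_tendsto_compose[OF this u[OF that] u_in[OF that]] U_in[OF that]
    show ?thesis by simp
  qed
  have ki: "kernel_integrable \<kappa> (\<lambda>s. F s (u s))"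
    by (rule neumann_green_dominated_convergence(1)[where h = "\<lambda>n s. F s (U n s)" and C = "\<kappa>\<^sup>2 * M"])
      (use \<open>\<kappa> > 0\<close> F_ki U_between F_abs U_in F_lim in auto)
  have "(\<lambda>n. T (U n) t) \<longlonglongrightarrow> T u t" if "t \<ge> 0" for t
    unfolding T_def
    by (rule neumann_green_dominated_convergence(2)[where C = "\<kappa>\<^sup>2 * M"])
      (use \<open>\<kappa> > 0\<close> F_ki U_between F_abs U_in F_lim that in auto)
  moreover have "(\<lambda>n. T (U n) t) \<longlonglongrightarrow> u t" if "t \<ge> 0" for t
    using LIMSEQ_Suc[OF u[OF that]] by (simp add: U_Suc)
  ultimately have fixed: "u t = T u t" if "t \<ge> 0" for t
    using LIMSEQ_unique that by blast
  \<comment> \<open>Regularity is gained in two stages: the fixed point equation makes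
    \<open>u\<close> continuous, and then \<open>F s (u s)\<close> is continuous, as differentiating
    the Green operator twice requires.\<close>
  have "continuous_on {0..} u"
    using continuous_on_neumann_green[OF ki \<open>\<kappa> > 0\<close>] fixed
    by (subst continuous_on_cong[OF refl, of _ _ "T u"]) (auto simp: T_def)
  then have "between u" using u_in by (simp add: between_def)
  from neumann_green_solves[OF ki \<open>\<kappa> > 0\<close> F_cont[OF this]] obtain u'
    where u': "u' 0 = 0"
    "\<And>t. t \<ge> 0 \<Longrightarrow> (T u has_real_derivative u' t) (at t within {0..})"
    "\<And>t. t \<ge> 0 \<Longrightarrow> (u' has_real_derivative \<kappa>\<^sup>2 * T u t - F t (u t)) (at t within {0..})"
    unfolding T_def by metis
  show ?thesis
  proof
    show "u' 0 = 0" by fact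
    show "\<bar>u t\<bar> \<le> M" if "t \<ge> 0" for t using u_in[OF that] by (simp add: abs_le_iff)
    show "(u has_real_derivative u' t) (at t within {0..})" if "t \<ge> 0" for t
      by (rule has_field_derivative_transform_within[OF u'(2)[OF that] zero_less_one]) (use that fixed in auto)
    show "(u' has_real_derivative \<kappa>\<^sup>2 * u t - F t (u t)) (at t within {0..})" if "t \<ge> 0" for t
      using u'(3)[OF that] fixed[OF that] by simp
  qed
qed

section \<open>Uniqueness\<close>

text \<open>The energy \<open>w\<^sup>2 + w'\<^sup>2\<close> satisfies
  \<open>E' \<le> C * E\<close>, so \<open>exp (-C * t) * E t\<close> is nonincreasing; it starts at
  0 and is nonnegative.\<close>

lemma second_order_gronwall_zero:
  fixes w w' w'' :: "real \<Rightarrow> real"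
  assumes w: "\<And>t. t \<in> {0..b} \<Longrightarrow> (w has_real_derivative w' t) (at t within {0..b})"
    and w': "\<And>t. t \<in> {0..b} \<Longrightarrow> (w' has_real_derivative w'' t) (at t within {0..b})"
    and bound: "\<And>t. t \<in> {0..b} \<Longrightarrow> \<bar>w'' t\<bar> \<le> L * \<bar>w t\<bar>"
    and init: "w 0 = 0" "w' 0 = 0" and "b \<ge> 0"
  shows "w b = 0"
proof -
  \<comment> \<open>The 1 accounts for \<open>2 * w * w'\<close> and the other summand for
    \<open>2 * w' * w''\<close>; the absolute value is taken because \<open>L\<close> carries no
    sign.\<close>
  define C where "C = 1 + \<bar>L\<bar>"
  define E where "E t = (w t)\<^sup>2 + (w' t)\<^sup>2" for t
  define E' where "E' t = 2 * w t * w' t + 2 * w' t * w'' t" for t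
  have E: "(E has_real_derivative E' t) (at t within {0..b})" if "t \<in> {0..b}" for t
    unfolding E_def E'_def by (auto intro!: derivative_eq_intros w w' that)
  have E'_le: "E' t \<le> C * E t" if "t \<in> {0..b}" for t
  proof -
    have young: "2 * \<bar>w t\<bar> * \<bar>w' t\<bar> \<le> E t"
      using sum_squares_bound[of "\<bar>w t\<bar>" "\<bar>w' t\<bar>"] by (simp add: E_def)
    have "\<bar>w'' t\<bar> \<le> \<bar>L\<bar> * \<bar>w t\<bar>"
      using bound[OF that] by (meson abs_ge_self abs_ge_zero mult_right_mono order_trans)
    have "E' t \<le> \<bar>E' t\<bar>" by simp
    also have "\<dots> \<le> \<bar>2 * w t * w' t\<bar> + \<bar>2 * w' t * w'' t\<bar>"
      unfolding E'_def by (rule abs_triangle_ineq)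
    also have "\<dots> \<le> 2 * \<bar>w t\<bar> * \<bar>w' t\<bar> + 2 * \<bar>w' t\<bar> * (\<bar>L\<bar> * \<bar>w t\<bar>)"
      using \<open>\<bar>w'' t\<bar> \<le> _\<close> by (auto simp: abs_mult intro!: mult_left_mono)
    also have "\<dots> = C * (2 * \<bar>w t\<bar> * \<bar>w' t\<bar>)"
      by (simp add: C_def algebra_simps)
    also have "\<dots> \<le> C * E t"
      by (rule mult_left_mono[OF young]) (simp add: C_def)
    finally show ?thesis .
  qed
  have "exp (-C * b) * E b \<le> exp (-C * 0) * E 0"
  proof (rule DERIV_nonpos_imp_decreasing_open[OF \<open>b \<ge> 0\<close>])
    have "continuous_on {0..b} E"
      using E by (rule DERIV_continuous_on)
    then show "continuous_on {0..b} (\<lambda>t. exp (-C * t) * E t)"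
      by (intro continuous_intros)
    fix t assume t: "0 < t" "t < b"
    then have "(E has_real_derivative E' t) (at t)"
      using E[of t] by (simp add: at_within_Icc_at)
    then have "((\<lambda>t. exp (-C * t) * E t) has_real_derivative exp (-C * t) * (E' t - C * E t)) (at t)"
      by (auto intro!: derivative_eq_intros simp: algebra_simps)
    moreover have "exp (-C * t) * (E' t - C * E t) \<le> 0"
      using E'_le[of t] t by (intro mult_nonneg_nonpos) auto
    ultimately show "\<exists>y. ((\<lambda>t. exp (-C * t) * E t) has_real_derivative y) (at t) \<and> y \<le> 0"
      by blast
  qed
  then have "E b \<le> 0"
    using init by (simp add: E_def mult_le_0_iff)
  then show ?thesis
    using sum_power2_le_zero_iff by (auto simp: E_def)
qed

text \<open>The difference factors through \<open>x - y\<close>. The bound serves twice: as a local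
  Lipschitz estimate for uniqueness, and to show that a large linear term makes \<open>F\<close>
  nondecreasing.\<close>

lemma cubic_diff_bound:
  fixes x y lam R :: real
  assumes "\<bar>x\<bar> \<le> R" "\<bar>y\<bar> \<le> R"
  shows "\<bar>(x ^ 3 - lam * x) - (y ^ 3 - lam * y)\<bar> \<le> (3 * R\<^sup>2 + \<bar>lam\<bar>) * \<bar>x - y\<bar>"
proof -
  have "(x ^ 3 - lam * x) - (y ^ 3 - lam * y) = (x * x + x * y + y * y - lam) * (x - y)"
    by (simp add: algebra_simps power3_eq_cube)
  moreover have "\<bar>x * x\<bar> \<le> R * R" "\<bar>x * y\<bar> \<le> R * R" "\<bar>y * y\<bar> \<le> R * R"
    unfolding abs_mult using assms by (intro mult_mono; simp)+
  then have "\<bar>x * x + x * y + y * y - lam\<bar> \<le> 3 * R\<^sup>2 + \<bar>lam\<bar>"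
    unfolding power2_eq_square by linarith
  ultimately show ?thesis
    by (simp add: abs_mult mult_right_mono)
qed

text \<open>The cubic is only locally Lipschitz, but on \<open>{0..b}\<close> both solutions are
  bounded by compactness, and the constant may depend on \<open>b\<close>. The forcing
  \<open>g\<close> cancels in the difference.\<close>

lemma solves_ivp_unique:
  assumes "\<epsilon> > 0" "solves_ivp g \<epsilon> lam \<alpha> u" "solves_ivp g \<epsilon> lam \<alpha> v" "b \<ge> 0"
  shows "u b = v b"
proof -
  obtain u' u'' where u: "\<And>t. t \<ge> 0 \<Longrightarrow> (u has_real_derivative u' t) (at t within {0..})"
      "\<And>t. t \<ge> 0 \<Longrightarrow> (u' has_real_derivative u'' t) (at t within {0..})"
      "\<And>t. t \<ge> 0 \<Longrightarrow> \<epsilon>\<^sup>2 * u'' t = (u t) ^ 3 - lam * u t + g t" "u 0 = \<alpha>" "u' 0 = 0"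
    using assms(2) unfolding solves_ivp_def by blast
  obtain v' v'' where v: "\<And>t. t \<ge> 0 \<Longrightarrow> (v has_real_derivative v' t) (at t within {0..})"
      "\<And>t. t \<ge> 0 \<Longrightarrow> (v' has_real_derivative v'' t) (at t within {0..})"
      "\<And>t. t \<ge> 0 \<Longrightarrow> \<epsilon>\<^sup>2 * v'' t = (v t) ^ 3 - lam * v t + g t" "v 0 = \<alpha>" "v' 0 = 0"
    using assms(3) unfolding solves_ivp_def by blast
  have bounded_Icc: "bounded (f ` {0..b})"
    if "\<And>t. t \<ge> 0 \<Longrightarrow> (f has_real_derivative f' t) (at t within {0..})" for f f' :: "real \<Rightarrow> real"
  proof -
    have "continuous_on {0..} f"
      by (rule DERIV_continuous_on) (use that in auto)
    then have "continuous_on {0..b} f" by (rule continuous_on_subset) auto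
    then show ?thesis by (intro compact_imp_bounded compact_continuous_image) auto
  qed
  obtain Ru where Ru: "\<And>t. t \<in> {0..b} \<Longrightarrow> \<bar>u t\<bar> \<le> Ru"
    using bounded_Icc[OF u(1)] unfolding bounded_real by blast
  obtain Rv where Rv: "\<And>t. t \<in> {0..b} \<Longrightarrow> \<bar>v t\<bar> \<le> Rv"
    using bounded_Icc[OF v(1)] unfolding bounded_real by blast
  define R where "R = max Ru Rv"
  have "u b - v b = 0"
  proof (rule second_order_gronwall_zero[where w = "\<lambda>t. u t - v t" and w' = "\<lambda>t. u' t - v' t"
        and w'' = "\<lambda>t. u'' t - v'' t" and L = "(3 * R\<^sup>2 + \<bar>lam\<bar>) / \<epsilon>\<^sup>2"])
    fix t assume t: "t \<in> {0..b}"
    have sub: "{0..b} \<subseteq> {0..}" by auto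
    show "((\<lambda>t. u t - v t) has_real_derivative u' t - v' t) (at t within {0..b})"
      using t by (intro DERIV_diff has_field_derivative_subset[OF u(1) sub] has_field_derivative_subset[OF v(1) sub]) auto
    show "((\<lambda>t. u' t - v' t) has_real_derivative u'' t - v'' t) (at t within {0..b})"
      using t by (intro DERIV_diff has_field_derivative_subset[OF u(2) sub] has_field_derivative_subset[OF v(2) sub]) auto
    have "\<epsilon>\<^sup>2 * (u'' t - v'' t) = ((u t) ^ 3 - lam * u t) - ((v t) ^ 3 - lam * v t)"
      using u(3)[of t] v(3)[of t] t by (simp add: right_diff_distrib)
    moreover have "\<bar>((u t) ^ 3 - lam * u t) - ((v t) ^ 3 - lam * v t)\<bar> \<le> (3 * R\<^sup>2 + \<bar>lam\<bar>) * \<bar>u t - v t\<bar>"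
      by (rule cubic_diff_bound) (use Ru[OF t] Rv[OF t] in \<open>auto simp: R_def\<close>)
    ultimately have "\<epsilon>\<^sup>2 * \<bar>u'' t - v'' t\<bar> \<le> (3 * R\<^sup>2 + \<bar>lam\<bar>) * \<bar>u t - v t\<bar>"
      by (metis abs_mult abs_power2)
    then show "\<bar>u'' t - v'' t\<bar> \<le> (3 * R\<^sup>2 + \<bar>lam\<bar>) / \<epsilon>\<^sup>2 * \<bar>u t - v t\<bar>"
      using \<open>\<epsilon> > 0\<close> by (simp add: field_simps)
  qed (use u v \<open>b \<ge> 0\<close> in auto)
  then show ?thesis by simp
qed

section \<open>Choice of constants for the cubic, existence and boundedness\<close>

theorem proposition1:
  fixes g :: "real \<Rightarrow> real" and \<epsilon> lam :: real
  assumes "continuous_on {0..} g"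
    and "bounded (g ` {0..})"
    and "\<epsilon> > 0"
  shows "\<exists>\<alpha>. (\<exists>u. solves_ivp g \<epsilon> lam \<alpha> u) \<and>
             (\<forall>u. solves_ivp g \<epsilon> lam \<alpha> u \<longrightarrow> bounded (u ` {0..}))"
proof -
  obtain C where C: "\<And>t. t \<ge> 0 \<Longrightarrow> \<bar>g t\<bar> \<le> C"
    using assms(2) by (auto simp: bounded_real)
  have "C \<ge> 0" using C[of 0] by simp
  \<comment> \<open>Chosen so that \<open>M \<ge> 1\<close> and
    \<open>M\<^sup>2 - lam \<ge> M - lam \<ge> C\<close>; hence \<open>M ^ 3 - lam * M\<close>
    dominates \<open>\<bar>g t\<bar>\<close>.\<close>
  define M where "M = 1 + \<bar>lam\<bar> + C"
  \<comment> \<open>A Lipschitz constant of \<open>x ^ 3 - lam * x\<close> on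
    \<open>{-M..M}\<close>. With \<open>\<kappa>\<^sup>2 = K / \<epsilon>\<^sup>2\<close>, the
    expression \<open>\<kappa>\<^sup>2 * x - F t x\<close> is exactly the right-hand side of the
    equation divided by \<open>\<epsilon>\<^sup>2\<close>.\<close>
  define K where "K = 3 * M\<^sup>2 + \<bar>lam\<bar>"
  define \<kappa> where "\<kappa> = sqrt K / \<epsilon>"
  define F where "F t x = (K * x - (x ^ 3 - lam * x + g t)) / \<epsilon>\<^sup>2" for t x
  have "M \<ge> 1" using \<open>C \<ge> 0\<close> by (simp add: M_def)
  have "K > 0" using \<open>M \<ge> 1\<close> by (auto simp: K_def intro!: add_pos_nonneg)
  have "\<kappa> > 0" using \<open>K > 0\<close> \<open>\<epsilon> > 0\<close> by (simp add: \<kappa>_def)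
  have \<kappa>2: "\<kappa>\<^sup>2 = K / \<epsilon>\<^sup>2" using \<open>K > 0\<close> by (simp add: \<kappa>_def power_divide)
  have barrier: "M ^ 3 - lam * M \<ge> C"
  proof -
    have "M * 1 \<le> M * M" using \<open>M \<ge> 1\<close> by (intro mult_left_mono) auto
    then have "C \<le> M * M - lam" by (simp add: M_def) 
    then have "1 * C \<le> M * (M * M - lam)"
      using \<open>M \<ge> 1\<close> \<open>C \<ge> 0\<close> by (intro mult_mono) auto
    then show ?thesis by (simp add: algebra_simps power3_eq_cube)
  qed
  have cont_F: "continuous_on ({0..} \<times> {-M..M}) (\<lambda>(t, x). F t x)"
  proof -
    have "continuous_on ({0..} \<times> {-M..M}) (\<lambda>p. g (fst p))"
      by (rule continuous_on_compose2[OF assms(1)]) (auto intro!: continuous_intros)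
    then show ?thesis
      unfolding F_def case_prod_unfold using \<open>\<epsilon> > 0\<close> by (auto intro!: continuous_intros)
  qed
  obtain u u' where u: "u' 0 = 0" "\<And>t. t \<ge> 0 \<Longrightarrow> \<bar>u t\<bar> \<le> M"
    "\<And>t. t \<ge> 0 \<Longrightarrow> (u has_real_derivative u' t) (at t within {0..})"
    "\<And>t. t \<ge> 0 \<Longrightarrow> (u' has_real_derivative \<kappa>\<^sup>2 * u t - F t (u t)) (at t within {0..})"
  proof (rule neumann_bounded_solution[OF \<open>\<kappa> > 0\<close> _ cont_F])
    fix t x y :: real assume *: "t \<ge> 0" "-M \<le> x" "x \<le> y" "y \<le> M"
    have "\<bar>(y ^ 3 - lam * y) - (x ^ 3 - lam * x)\<bar> \<le> K * \<bar>y - x\<bar>"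
      unfolding K_def by (rule cubic_diff_bound) (use * in auto)
    then have "K * x - (x ^ 3 - lam * x + g t) \<le> K * y - (y ^ 3 - lam * y + g t)"
      using * by (simp add: algebra_simps)
    then show "F t x \<le> F t y"
      unfolding F_def by (rule divide_right_mono) simp
  next
    fix t :: real assume "t \<ge> 0"
    \<comment> \<open>The linear terms in \<open>K\<close> cancel and \<open>barrier\<close>
      remains; the bound at \<open>-M\<close> follows likewise because the cubic is odd.\<close>
    show "F t M \<le> \<kappa>\<^sup>2 * M"
      unfolding F_def \<kappa>2 times_divide_eq_left
      by (rule divide_right_mono) (use barrier C[OF \<open>t \<ge> 0\<close>] in auto)
    show "\<kappa>\<^sup>2 * (-M) \<le> F t (-M)"
      unfolding F_def \<kappa>2 times_divide_eq_left
      by (rule divide_right_mono) (use barrier C[OF \<open>t \<ge> 0\<close>] in \<open>auto simp: power3_eq_cube\<close>)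
  qed (use \<open>M \<ge> 1\<close> in auto)
  have sol: "solves_ivp g \<epsilon> lam (u 0) u"
    unfolding solves_ivp_def
  proof (intro exI conjI allI impI)
    fix t :: real assume t: "t \<ge> 0"
    show "(u has_real_derivative u' t) (at t within {0..})" by (rule u(3)[OF t])
    show "(u' has_real_derivative \<kappa>\<^sup>2 * u t - F t (u t)) (at t within {0..})" by (rule u(4)[OF t])
    show "\<epsilon>\<^sup>2 * (\<kappa>\<^sup>2 * u t - F t (u t)) = (u t) ^ 3 - lam * u t + g t"
      using \<open>\<epsilon> > 0\<close> by (simp add: \<kappa>2 F_def field_simps)
  qed (use u(1) in auto)
  \<comment> \<open>Any solution with the same initial value agrees with \<open>u\<close> on the
    half-line, so it inherits the bound \<open>M\<close>.\<close>
  have "bounded (v ` {0..})" if "solves_ivp g \<epsilon> lam (u 0) v" for v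
    using u(2) solves_ivp_unique[OF \<open>\<epsilon> > 0\<close> that sol] by (auto simp: bounded_real)
  with sol show ?thesis by blast
qed

end
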